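(* Let $\beta>0$, $v_0>0$, $s_c>0$, $\alpha\in\mathbb{R}$, $\sigma_0\ge 0$, let $s_e>0$, and let $v_e=V_{op}(s_e)>0$ be the corresponding equilibrium speed. The stochastic car-following model $$dv_n(t)=\beta\left[V_{op}(s_n(t))-v_n(t)\right]dt+\sigma_0\sqrt{v_n(t)}\,dW_n(t)$$ is locally (stochastically) stable at the equilibrium $(s_e,v_e)$, in the sense defined in the context, if $$\sigma_0^2\le 8\beta v_e .$$
   Context: Optimal velocity function: $V_{op}(s)=\frac{v_0}{2}\left[\tanh\left(\frac{s}{s_c}-\alpha\right)+\tanh\alpha\right]$. Here $v_n$ is the speed of vehicle $n$ and $s_n$ is the gap to its leader $n-1$. All stochastic differential equations are understood in the Itô sense. Write $V_{op}'=V_{op}'(s_e)>0$ and $\gamma=\frac{\sigma_0}{2\sqrt{v_e}}$. Linearization: with $\delta s_n=s_n-s_e$, $\delta v_n=v_n-v_e$ denoting the deviations from equilibrium, and the leader's speed fixed ($\delta v_{n-1}=0$), the first-order linearization of the model together with $d\,\delta s_n=(\delta v_{n-1}-\delta v_n)\,dt$ is the linear system $$dU(t)=F\,U(t)\,dt+G\,U(t)\,dW(t),\qquad U=\begin{pmatrix}\delta s_n\\ \delta v_n\end{pmatrix},\quad F=\begin{pmatrix}0&-1\\ \beta V_{op}'&-\beta\end{pmatrix},\quad G=\begin{pmatrix}0&0\\0&\gamma\end{pmatrix},$$ where $W$ is a standard one-dimensional Wiener process and $U(t)\in\mathbb{R}^2$. Local stability: let $\Phi$ be the family of all continuous non-decreasing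 functions $\phi:[0,\infty)\to[0,\infty)$ with $\phi(0)=0$ and $\phi(r)>0$ for $r>0$. The model is called locally (stochastically) stable at $(s_e,v_e)$ if the trivial solution of the linear system above is locally stochastically stable, meaning that there is a twice continuously differentiable (Lyapunov) function $V:\mathbb{R}^2\to\mathbb{R}$ such that for all $U\in\mathbb{R}^2$: (i) $V(U)\ge\phi(|U|)$ for some $\phi\in\Phi$ (independent of $U$); and (ii) $LV(U)\le 0$, where $LV(U)=\nabla V(U)^{T}F U+\frac12\operatorname{Tr}\left[(GU)^{T}\,\nabla^2V(U)\,GU\right]$, with $\nabla V$ the gradient and $\nabla^2 V$ the Hessian of $V$. *)

theory Defs
  imports "HOL-Analysis.Analysis"
begin

definition class_Phi :: "(real \<Rightarrow> real) set" where
  "class_Phi = {\<phi>. continuous_on {0..} \<phi> \<and> mono_on {0..} \<phi> \<and> (\<forall>r\<ge>0. \<phi> r \<ge> 0) \<and>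
                   \<phi> 0 = 0 \<and> (\<forall>r>0. \<phi> r > 0)}"

text \<open>\<open>V\<close> is twice continuously differentiable with gradient \<open>g\<close> and Hessian \<open>H\<close>. Continuity of
  \<open>V\<close> and \<open>g\<close> follows from their differentiability.\<close>

definition C2_with_gradient_hessian ::
    "(real^2 \<Rightarrow> real) \<Rightarrow> (real^2 \<Rightarrow> real^2) \<Rightarrow> (real^2 \<Rightarrow> real^2^2) \<Rightarrow> bool" where
  "C2_with_gradient_hessian V g H \<longleftrightarrow>
     (\<forall>U. GDERIV V U :> g U) \<and>
     (\<forall>U. (g has_derivative (\<lambda>h. H U *v h)) (at U)) \<and>
     continuous_on UNIV H"

text \<open>The Ito generator of \<open>dU = F U dt + G U dW\<close> with scalar noise \<open>W\<close>, for a function with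
  gradient \<open>g\<close> and Hessian \<open>H\<close>. The vector \<open>G U\<close> is a 2-by-1 matrix inside the trace.\<close>

definition ito_generator ::
    "real^2^2 \<Rightarrow> real^2^2 \<Rightarrow> (real^2 \<Rightarrow> real^2) \<Rightarrow> (real^2 \<Rightarrow> real^2^2) \<Rightarrow> real^2 \<Rightarrow> real" where
  "ito_generator F G g H U =
     (let B = (columnvector (G *v U) :: real^1^2)
      in g U \<bullet> (F *v U) + 1/2 * trace (transpose B ** H U ** B))"

text \<open>The normalization \<open>V 0 = 0\<close> is part of the usual meaning of Lyapunov function. Without it the
  constant function 1, with \<open>\<phi> r = min r 1\<close>, would satisfy the remaining conditions for every
  \<open>F\<close> and \<open>G\<close>.\<close>

definition trivial_solution_locally_stoch_stable :: "real^2^2 \<Rightarrow> real^2^2 \<Rightarrow> bool" where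
  "trivial_solution_locally_stoch_stable F G \<longleftrightarrow>
     (\<exists>V g H. C2_with_gradient_hessian V g H \<and> V 0 = 0 \<and>
        (\<exists>\<phi>\<in>class_Phi. \<forall>U. V U \<ge> \<phi> (norm U)) \<and>
        (\<forall>U. ito_generator F G g H U \<le> 0))"


definition V_op :: "real \<Rightarrow> real \<Rightarrow> real \<Rightarrow> real \<Rightarrow> real" where
  "V_op v0 sc \<alpha> s = v0 / 2 * (tanh (s / sc - \<alpha>) + tanh \<alpha>)"

text \<open>Drift and diffusion coefficients for the state (gap, speed); \<open>vl\<close> is the speed of the
  leader.\<close>

definition cf_drift :: "real \<Rightarrow> (real \<Rightarrow> real) \<Rightarrow> real \<Rightarrow> real^2 \<Rightarrow> real^2" where
  "cf_drift \<beta> V vl x = vector [vl - x $ 2, \<beta> * (V (x $ 1) - x $ 2)]"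

definition cf_diffusion :: "real \<Rightarrow> real^2 \<Rightarrow> real^2" where
  "cf_diffusion \<sigma>0 x = vector [0, \<sigma>0 * sqrt (x $ 2)]"

text \<open>A model \<open>dX = b X dt + a X dW\<close> is stable at \<open>e\<close> if its linearization
  \<open>dU = F U dt + G U dW\<close> is, where \<open>F\<close> and \<open>G\<close> are the Jacobians of \<open>b\<close> and \<open>a\<close> at \<open>e\<close>. The
  constant part \<open>a e\<close> of the noise is not retained in the linear system.\<close>

definition locally_stoch_stable_at ::
    "(real^2 \<Rightarrow> real^2) \<Rightarrow> (real^2 \<Rightarrow> real^2) \<Rightarrow> real^2 \<Rightarrow> bool" where
  "locally_stoch_stable_at b a e \<longleftrightarrow>
     (\<exists>F G. (b has_derivative (\<lambda>h. F *v h)) (at e) \<and>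
            (a has_derivative (\<lambda>h. G *v h)) (at e) \<and>
            trivial_solution_locally_stoch_stable F G)"

text \<open>The Jacobians of the car-following model; that they are the ones meant by
  \<open>locally_stoch_stable_at\<close> is \<open>locally_stoch_stable_at_car_following_iff\<close> below.\<close>

definition cf_F :: "real \<Rightarrow> real \<Rightarrow> real^2^2" where
  "cf_F \<beta> dV = vector [vector [0, -1], vector [\<beta> * dV, -\<beta>]]"

definition cf_G :: "real \<Rightarrow> real^2^2" where
  "cf_G \<gamma> = vector [vector [0, 0], vector [0, \<gamma>]]"

lemma V_op_has_deriv:
  assumes "sc \<noteq> 0"
  shows "(V_op v0 sc \<alpha> has_real_derivative deriv (V_op v0 sc \<alpha>) s) (at s)"
proof -
  have "(V_op v0 sc \<alpha> has_real_derivative v0 / 2 * ((1 - tanh (s / sc - \<alpha>) ^ 2) * (1 / sc))) (at s)"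
    unfolding V_op_def[abs_def] using assms by (auto intro!: derivative_eq_intros)
  then show ?thesis
    by (metis DERIV_imp_deriv)
qed

lemma vector_2_has_derivative:
  fixes f g :: "real^2 \<Rightarrow> real"
  assumes "(f has_derivative f') (at e)" "(g has_derivative g') (at e)"
  shows "((\<lambda>x. vector [f x, g x] :: real^2) has_derivative (\<lambda>h. vector [f' h, g' h])) (at e)"
proof -
  have eq: "(vector [a, b] :: real^2) = a *\<^sub>R axis 1 1 + b *\<^sub>R axis 2 1" for a b
    by (simp add: vec_eq_iff forall_2 axis_def)
  show ?thesis
    unfolding eq by (intro derivative_intros assms)
qed

lemma vec_nth_has_derivative: "((\<lambda>x. x $ i) has_derivative (\<lambda>h. h $ i)) (at (e :: real^2))"
  by (rule bounded_linear_imp_has_derivative) (rule bounded_linear_vec_nth)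

lemma cf_drift_has_derivative:
  assumes "(V has_real_derivative dV) (at (e $ 1))"
  shows "(cf_drift \<beta> V vl has_derivative (\<lambda>h. cf_F \<beta> dV *v h)) (at e)"
proof -
  have V: "((\<lambda>x. V (x $ 1)) has_derivative (\<lambda>h. dV * h $ 1)) (at e)"
    using has_derivative_compose[OF vec_nth_has_derivative[of 1] assms[unfolded has_field_derivative_def]]
    by simp
  have "((\<lambda>x. vector [vl - x $ 2, \<beta> * (V (x $ 1) - x $ 2)] :: real^2) has_derivative
      (\<lambda>h. vector [0 - h $ 2, \<beta> * (dV * h $ 1 - h $ 2)])) (at e)"
    by (intro vector_2_has_derivative has_derivative_diff has_derivative_mult_right
        has_derivative_const V vec_nth_has_derivative)
  moreover have "(vector [0 - h $ 2, \<beta> * (dV * h $ 1 - h $ 2)] :: real^2) = cf_F \<beta> dV *v h" for h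
    by (simp add: vec_eq_iff forall_2 cf_F_def matrix_vector_mult_def sum_2 algebra_simps)
  ultimately show ?thesis
    by (simp add: cf_drift_def[abs_def])
qed

lemma cf_diffusion_has_derivative:
  assumes "e $ 2 > 0"
  shows "(cf_diffusion \<sigma>0 has_derivative (\<lambda>h. cf_G (\<sigma>0 / (2 * sqrt (e $ 2))) *v h)) (at e)"
proof -
  have S: "((\<lambda>x. sqrt (x $ 2)) has_derivative (\<lambda>h. inverse (sqrt (e $ 2)) / 2 * h $ 2)) (at e)"
    using has_derivative_compose[OF vec_nth_has_derivative[of 2]
        DERIV_real_sqrt[OF assms, unfolded has_field_derivative_def]]
    by simp
  have "((\<lambda>x. vector [0, \<sigma>0 * sqrt (x $ 2)] :: real^2) has_derivative
      (\<lambda>h. vector [0, \<sigma>0 * (inverse (sqrt (e $ 2)) / 2 * h $ 2)])) (at e)"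
    by (intro vector_2_has_derivative has_derivative_mult_right has_derivative_const S)
  moreover have "(vector [0, \<sigma>0 * (inverse (sqrt (e $ 2)) / 2 * h $ 2)] :: real^2)
      = cf_G (\<sigma>0 / (2 * sqrt (e $ 2))) *v h" for h
    by (simp add: vec_eq_iff forall_2 cf_G_def matrix_vector_mult_def sum_2 field_simps)
  ultimately show ?thesis
    by (simp add: cf_diffusion_def[abs_def])
qed

lemma locally_stoch_stable_at_car_following_iff:
  assumes "sc \<noteq> 0" "ve > 0"
  shows "locally_stoch_stable_at (cf_drift \<beta> (V_op v0 sc \<alpha>) vl) (cf_diffusion \<sigma>0) (vector [se, ve]) \<longleftrightarrow>
    trivial_solution_locally_stoch_stable (cf_F \<beta> (deriv (V_op v0 sc \<alpha>) se))
      (cf_G (\<sigma>0 / (2 * sqrt ve)))"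
proof -
  let ?e = "vector [se, ve] :: real^2"
  have uniq: "A = B" if "(f has_derivative (\<lambda>h. A *v h)) (at e)" "(f has_derivative (\<lambda>h. B *v h)) (at e)"
    for f :: "real^2 \<Rightarrow> real^2" and e and A B :: "real^2^2"
    using has_derivative_unique[OF that] by (metis matrix_of_matrix_vector_mul)
  have F: "(cf_drift \<beta> (V_op v0 sc \<alpha>) vl has_derivative
      (\<lambda>h. cf_F \<beta> (deriv (V_op v0 sc \<alpha>) se) *v h)) (at ?e)"
    by (intro cf_drift_has_derivative) (simp add: V_op_has_deriv assms)
  have G: "(cf_diffusion \<sigma>0 has_derivative (\<lambda>h. cf_G (\<sigma>0 / (2 * sqrt ve)) *v h)) (at ?e)"
    using cf_diffusion_has_derivative[of ?e \<sigma>0] assms by simp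
  show ?thesis
    unfolding locally_stoch_stable_at_def using F G uniq by metis
qed

end

theory Submission
  imports Defs
begin

text \<open>The quadratic form \<open>k s\<^sup>2 + v\<^sup>2\<close> with \<open>k = \<beta> V_op'(s_e)\<close> is a Lyapunov function: this weight makes
  the mixed terms in \<open>s v\<close> cancel, leaving \<open>LV = (\<gamma>\<^sup>2 - 2 \<beta>) v\<^sup>2\<close>.\<close>

text \<open>The derivative is \<open>v0 / (2 * sc)\<close> times \<open>1 - tanh\<^sup>2\<close>,
  and \<open>tanh\<close> lies strictly between -1 and 1. This makes the weight k of the Lyapunov
  function positive.\<close>

lemma V_op_deriv_pos:
  assumes "v0 > 0" "sc > 0"
  shows "deriv (V_op v0 sc \<alpha>) s > 0"
proof -
  have "(V_op v0 sc \<alpha> has_real_derivative v0 / 2 * ((1 - tanh (s / sc - \<alpha>) ^ 2) * (1 / sc))) (at s)"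
    unfolding V_op_def[abs_def] using assms by (auto intro!: derivative_eq_intros)
  then have "deriv (V_op v0 sc \<alpha>) s = v0 / 2 * ((1 - tanh (s / sc - \<alpha>) ^ 2) * (1 / sc))"
    by (rule DERIV_imp_deriv)
  moreover have "tanh (s / sc - \<alpha>) ^ 2 < 1"
    using tanh_real_lt_1[of "s / sc - \<alpha>"] tanh_real_gt_neg1[of "s / sc - \<alpha>"]
    by (simp add: abs_square_less_1)
  ultimately show ?thesis
    using assms by simp
qed

lemma C2_diagonal_quadratic_form:
  fixes a b :: real
  shows "C2_with_gradient_hessian (\<lambda>U. a * (U $ 1)\<^sup>2 + b * (U $ 2)\<^sup>2)
    (\<lambda>U. vector [2 * a * U $ 1, 2 * b * U $ 2])
    (\<lambda>_. vector [vector [2 * a, 0], vector [0, 2 * b]])"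
  unfolding C2_with_gradient_hessian_def
proof (intro conjI allI)
  fix U :: "real^2"
  have "((\<lambda>U. a * (U $ 1)\<^sup>2 + b * (U $ 2)\<^sup>2) has_derivative
      (\<lambda>h. a * (2 * U $ 1 * h $ 1) + b * (2 * U $ 2 * h $ 2))) (at U)"
    by (auto intro!: derivative_eq_intros vec_nth_has_derivative simp: algebra_simps)
  moreover have "a * (2 * U $ 1 * h $ 1) + b * (2 * U $ 2 * h $ 2)
      = h \<bullet> vector [2 * a * U $ 1, 2 * b * U $ 2]" for h :: "real^2"
    by (simp add: inner_vec_def sum_2 algebra_simps)
  ultimately show "GDERIV (\<lambda>U. a * (U $ 1)\<^sup>2 + b * (U $ 2)\<^sup>2) U
      :> vector [2 * a * U $ 1, 2 * b * U $ 2]"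
    by (simp add: gderiv_def)
  have "((\<lambda>U. vector [2 * a * U $ 1, 2 * b * U $ 2] :: real^2) has_derivative
      (\<lambda>h. vector [2 * a * h $ 1, 2 * b * h $ 2])) (at U)"
    by (intro vector_2_has_derivative has_derivative_mult_right vec_nth_has_derivative)
  moreover have "(vector [2 * a * h $ 1, 2 * b * h $ 2] :: real^2)
      = vector [vector [2 * a, 0], vector [0, 2 * b]] *v h" for h :: "real^2"
    by (simp add: vec_eq_iff forall_2 matrix_vector_mult_def sum_2)
  ultimately show "((\<lambda>U. vector [2 * a * U $ 1, 2 * b * U $ 2] :: real^2) has_derivative
      (\<lambda>h. vector [vector [2 * a, 0], vector [0, 2 * b]] *v h)) (at U)"
    by simp
qed simp

text \<open>After cancellation the drift contributes \<open>-2 * \<beta> * v\<^sup>2\<close>; the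
  noise contributes half the Hessian entry 2 times \<open>(\<gamma> * v)\<^sup>2\<close>. The
  factors \<open>2 * 1\<close> stay unevaluated so that gradient and Hessian are literally those of
  \<open>C2_diagonal_quadratic_form\<close> with \<open>a = \<beta> * dV\<close> and
  \<open>b = 1\<close>.\<close>

lemma ito_generator_car_following_quadratic:
  "ito_generator (cf_F \<beta> dV) (cf_G \<gamma>)
    (\<lambda>U. vector [2 * (\<beta> * dV) * U $ 1, 2 * 1 * U $ 2])
    (\<lambda>_. vector [vector [2 * (\<beta> * dV), 0], vector [0, 2 * 1]]) U = (\<gamma>\<^sup>2 - 2 * \<beta>) * (U $ 2)\<^sup>2"
  by (simp add: ito_generator_def cf_F_def cf_G_def inner_vec_def trace_def transpose_def
      columnvector_def matrix_matrix_mult_def matrix_vector_mult_def sum_2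
      power2_eq_square algebra_simps)

lemma square_scaled_in_class_Phi:
  assumes "m > 0"
  shows "(\<lambda>r. m * r\<^sup>2) \<in> class_Phi"
  using assms unfolding class_Phi_def
  by (auto intro!: continuous_intros mono_onI mult_left_mono power_mono)

text \<open>The first hypothesis makes the quadratic form positive definite, the second makes its
  generator nonpositive.\<close>

lemma car_following_linear_stable:
  assumes "\<beta> * dV > 0" "\<gamma>\<^sup>2 \<le> 2 * \<beta>"
  shows "trivial_solution_locally_stoch_stable (cf_F \<beta> dV) (cf_G \<gamma>)"
proof -
  \<comment> \<open>The smaller coefficient of the diagonal form, hence its least eigenvalue: the
    form dominates \<open>?m\<close> times the squared norm.\<close>
  let ?m = "min (\<beta> * dV) 1"
  have lower: "?m * (norm U)\<^sup>2 \<le> \<beta> * dV * (U $ 1)\<^sup>2 + 1 * (U $ 2)\<^sup>2" for U :: "real^2"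
  proof -
    have "(norm U)\<^sup>2 = (U $ 1)\<^sup>2 + (U $ 2)\<^sup>2"
      unfolding power2_norm_eq_inner by (simp add: inner_vec_def sum_2 power2_eq_square)
    then show ?thesis
      by (simp only: distrib_left) (intro add_mono mult_right_mono; simp)
  qed
  have Phi: "(\<lambda>r. ?m * r\<^sup>2) \<in> class_Phi"
    using assms by (intro square_scaled_in_class_Phi) simp
  have LV: "ito_generator (cf_F \<beta> dV) (cf_G \<gamma>)
    (\<lambda>U. vector [2 * (\<beta> * dV) * U $ 1, 2 * 1 * U $ 2])
    (\<lambda>_. vector [vector [2 * (\<beta> * dV), 0], vector [0, 2 * 1]]) U \<le> 0" for U
    unfolding ito_generator_car_following_quadratic
    using assms by (intro mult_nonpos_nonneg) auto
  show ?thesis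
    unfolding trivial_solution_locally_stoch_stable_def
  proof (intro exI conjI)
    \<comment> \<open>The witnesses are still schematic here. This goal fixes V, and
      \<open>C2_diagonal_quadratic_form\<close> at the end then fixes its gradient and
      Hessian.\<close>
    show "\<exists>\<phi>\<in>class_Phi. \<forall>U :: real^2. \<phi> (norm U) \<le> \<beta> * dV * (U $ 1)\<^sup>2 + 1 * (U $ 2)\<^sup>2"
      by (intro bexI[OF _ Phi] allI lower)
    show "\<beta> * dV * ((0 :: real^2) $ 1)\<^sup>2 + 1 * ((0 :: real^2) $ 2)\<^sup>2 = 0"
      by simp
  qed (rule C2_diagonal_quadratic_form allI LV)+
qed

theorem theorem1:
  fixes \<beta> v0 sc \<alpha> \<sigma>0 se ve :: real
  assumes "\<beta> > 0" and "v0 > 0" and "sc > 0" and "\<sigma>0 \<ge> 0" and "se > 0"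
    and "ve = V_op v0 sc \<alpha> se" and "ve > 0"
    and "\<sigma>0\<^sup>2 \<le> 8 * \<beta> * ve"
  shows "locally_stoch_stable_at (cf_drift \<beta> (V_op v0 sc \<alpha>) ve) (cf_diffusion \<sigma>0) (vector [se, ve])"
proof -
  \<comment> \<open>The left side equals \<open>\<sigma>0\<^sup>2 / (4 * ve)\<close>, so this is the
    assumed noise bound divided by \<open>4 * ve\<close>.\<close>
  have "(\<sigma>0 / (2 * sqrt ve))\<^sup>2 \<le> 2 * \<beta>"
    using assms by (simp add: power_divide power_mult_distrib divide_simps algebra_simps)
  moreover have "\<beta> * deriv (V_op v0 sc \<alpha>) se > 0"
    using assms V_op_deriv_pos by simp
  moreover have "sc \<noteq> 0"
    using assms by simp
  ultimately show ?thesis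
    using locally_stoch_stable_at_car_following_iff car_following_linear_stable assms(7) by blast
qed

end
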